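(* Let $\mathfrak{A}$ be a unital complex Jordan--Banach algebra, and let $f\colon\mathfrak{A}\to\mathbb{C}$ be a (not necessarily linear) functional such that $$f(x)\in\text{J-}\sigma(x)\quad\text{and}\quad f(x\circ y)=f(x)f(y)\qquad\text{for all }x,y\in\mathfrak{A}.$$ Then there exists a unique continuous complex-linear functional $\psi\colon\mathfrak{A}\to\mathbb{C}$ which is multiplicative (that is, $\psi(x\circ y)=\psi(x)\psi(y)$ for all $x,y\in\mathfrak{A}$) and satisfies $$f(e^x)=\psi(e^x)\quad\text{for all }x\in\mathfrak{A}.$$
   Context: A complex Jordan--Banach algebra is a complex Banach space $\mathfrak{A}$ with a bilinear product $(a,b)\mapsto a\circ b$ satisfying $\|a\circ b\|\le\|a\|\,\|b\|$, $a\circ b=b\circ a$, and $(a^2\circ b)\circ a=(a\circ b)\circ a^2$ for all $a,b$ (where $a^2=a\circ a$). It is unital if there is $\mathbf{1}\in\mathfrak{A}$ with $\mathbf{1}\circ a=a$ for all $a$. Powers are $a^0=\mathbf{1}$, $a^{n+1}=a\circ a^n$, and $e^a=\sum_{n\ge 0}a^n/n!$. An element $a$ is invertible if there is $b\in\mathfrak{A}$ with $a\circ b=\mathbf{1}$ and $a^2\circ b=a$. The (Jordan-)spectrum of $a$ is $\text{J-}\sigma(a)=\{\lambda\in\mathbb{C}: a-\lambda\mathbf{1}\text{ is not invertible}\}$. *)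

theory Defs
  imports "HOL-Analysis.Analysis"
begin

text \<open>
  The class \<^class>\<open>banach\<close> only provides real Banach spaces. A complex Banach space is one that
  carries a complex scalar multiplication extending the real one, with a homogeneous norm.
\<close>

locale complex_banach_space = vector_space scaleC
  for scaleC :: "complex \<Rightarrow> 'a::banach \<Rightarrow> 'a" (infixr "*\<^sub>C" 75) +
  assumes scaleC_of_real: "of_real r *\<^sub>C x = r *\<^sub>R x"
    and norm_scaleC: "norm (c *\<^sub>C x) = cmod c * norm x"

locale jordan_banach_algebra = complex_banach_space scaleC
  for scaleC :: "complex \<Rightarrow> 'a::banach \<Rightarrow> 'a" (infixr "*\<^sub>C" 75) +
  fixes jprod :: "'a \<Rightarrow> 'a \<Rightarrow> 'a" (infixl "\<bullet>\<^sub>J" 70)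
  assumes linear_right: "Vector_Spaces.linear scaleC scaleC (\<lambda>b. a \<bullet>\<^sub>J b)"
    and linear_left: "Vector_Spaces.linear scaleC scaleC (\<lambda>a. a \<bullet>\<^sub>J b)"
    and norm_jprod: "norm (a \<bullet>\<^sub>J b) \<le> norm a * norm b"
    and jprod_commute: "a \<bullet>\<^sub>J b = b \<bullet>\<^sub>J a"
    and jordan_identity: "((a \<bullet>\<^sub>J a) \<bullet>\<^sub>J b) \<bullet>\<^sub>J a = (a \<bullet>\<^sub>J b) \<bullet>\<^sub>J (a \<bullet>\<^sub>J a)"

text \<open>
  The unit is necessarily unique, so it may be taken as a parameter. Its norm is not assumed to be 1,
  and the zero algebra is not excluded.
\<close>

locale unital_jordan_banach_algebra = jordan_banach_algebra scaleC jprod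
  for scaleC :: "complex \<Rightarrow> 'a::banach \<Rightarrow> 'a" (infixr "*\<^sub>C" 75)
    and jprod :: "'a \<Rightarrow> 'a \<Rightarrow> 'a" (infixl "\<bullet>\<^sub>J" 70) +
  fixes unit :: 'a ("\<one>\<^sub>J")
  assumes unit_left: "\<one>\<^sub>J \<bullet>\<^sub>J a = a"

primrec jpower :: "('a \<Rightarrow> 'a \<Rightarrow> 'a) \<Rightarrow> 'a \<Rightarrow> 'a \<Rightarrow> nat \<Rightarrow> 'a" where
  "jpower jprod unit a 0 = unit"
| "jpower jprod unit a (Suc n) = jprod a (jpower jprod unit a n)"

definition jexp :: "('a::banach \<Rightarrow> 'a \<Rightarrow> 'a) \<Rightarrow> 'a \<Rightarrow> 'a \<Rightarrow> 'a" where
  "jexp jprod unit a = (\<Sum>n. jpower jprod unit a n /\<^sub>R fact n)"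

definition jinvertible :: "('a \<Rightarrow> 'a \<Rightarrow> 'a) \<Rightarrow> 'a \<Rightarrow> 'a \<Rightarrow> bool" where
  "jinvertible jprod unit a \<longleftrightarrow> (\<exists>b. jprod a b = unit \<and> jprod (jprod a a) b = a)"

definition jspectrum ::
  "(complex \<Rightarrow> 'a \<Rightarrow> 'a) \<Rightarrow> ('a \<Rightarrow> 'a \<Rightarrow> 'a) \<Rightarrow> 'a \<Rightarrow> 'a::banach \<Rightarrow> complex set" where
  "jspectrum scaleC jprod unit a = {l. \<not> jinvertible jprod unit (a - scaleC l unit)}"

end

theory Submission
  imports Defs "HOL-Computational_Algebra.Fundamental_Theorem_Algebra"
begin

text \<open>
  The functional \<open>f\<close> is multiplicative on the group of all \<open>exp (t x)\<close> with real \<open>t\<close>, and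
  \<open>\<bar>f a - 1\<bar> \<le> \<parallel>a - 1\<parallel>\<close> because \<open>f a\<close> lies in the spectrum. Hence
  \<open>f (exp (t x)) = exp (t \<psi> x)\<close> for some \<open>\<psi> x\<close> with \<open>\<bar>\<psi> x\<bar> \<le> \<parallel>x\<parallel>\<close>. The curve
  \<open>exp (- t (x + y)) (exp (t x) exp (t y))\<close> has derivative \<open>0\<close> at \<open>t = 0\<close>, so \<open>\<psi>\<close> is additive.

  Write the real-linear \<open>\<psi>\<close> as \<open>p\<^sub>1 + cnj p\<^sub>2\<close> with complex-linear \<open>p\<^sub>1, p\<^sub>2\<close>. It does not vanish at
  \<open>u (1 - t x)\<^sup>n\<close> for \<open>u \<noteq> 0\<close> and \<open>\<bar>t\<bar> \<parallel>x\<parallel> < 1\<close>; rotating \<open>u\<close> gives \<open>\<bar>p\<^sub>1\<bar> \<noteq> \<bar>p\<^sub>2\<bar>\<close> there, and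
  \<open>\<bar>p\<^sub>1\<bar> > \<bar>p\<^sub>2\<bar>\<close> by continuity from \<open>t = 0\<close>. So for \<open>\<bar>c\<bar> \<le> 1\<close> and \<open>L = p\<^sub>1 + c p\<^sub>2\<close> the polynomial
  \<open>L ((1 - t x)\<^sup>n)\<close> in \<open>t\<close> has no root with \<open>\<bar>t\<bar> \<parallel>x\<parallel> < 1\<close>. Comparing its first coefficients with the
  sum of squares of the reciprocal roots and letting \<open>n\<close> grow gives \<open>L (x\<^sup>2) = (L x)\<^sup>2\<close>. The values
  \<open>c = 0, 1, -1\<close> force \<open>p\<^sub>2 = 0\<close>, and polarization makes \<open>\<psi> = p\<^sub>1\<close> multiplicative.
\<close>

section \<open>One-parameter groups of complex numbers, polynomial roots, exponential double
  sums\<close>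

lemma exp_of_real_mult_has_vector_derivative:
  "((\<lambda>t. exp (of_real t * c)) has_vector_derivative c * exp (of_real t * c)) (at t)" for c :: complex
proof -
  have "((\<lambda>t. exp (t *\<^sub>R c)) has_vector_derivative c * exp (t *\<^sub>R c)) (at t)"
    by (rule exp_scaleR_has_vector_derivative_left)
  then show ?thesis by (simp add: scaleR_conv_of_real)
qed

text \<open>A single value of \<open>exp\<close> determines the exponent only modulo
  \<open>2 * pi * i\<close>; agreement for all real \<open>t\<close> recovers it as the derivative
  at 0.\<close>

lemma exp_of_real_mult_inject:
  fixes a b :: complex
  assumes "\<And>t. exp (of_real t * a) = exp (of_real t * b)"
  shows "a = b"
proof -
  have "((\<lambda>t. exp (of_real t * a)) has_vector_derivative a) (at 0)"
    using exp_of_real_mult_has_vector_derivative[of a 0] by simp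
  moreover have "((\<lambda>t. exp (of_real t * a)) has_vector_derivative b) (at 0)"
    using exp_of_real_mult_has_vector_derivative[of b 0] by (simp add: assms)
  ultimately show ?thesis by (rule vector_derivative_unique_at)
qed

text \<open>Averaging \<open>g (s + u) = g s * g u\<close> over a short interval of \<open>u\<close> shows that \<open>g\<close> is
  differentiable.\<close>

lemma continuous_one_parameter_group:
  fixes g :: "real \<Rightarrow> complex"
  assumes add: "\<And>s t. g (s + t) = g s * g t"
    and g0: "g 0 = 1" and cont: "isCont g 0"
  obtains c where "\<And>t. g t = exp (of_real t * c)"
proof -
  have cont': "continuous_on A g" for A
  proof (rule continuous_at_imp_continuous_on, rule ballI)
    fix t
    have "((\<lambda>h. g t * g h) \<longlongrightarrow> g t * g 0) (at 0)"
      using cont by (intro tendsto_intros) (simp add: isCont_def)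
    then show "isCont g t"
      by (simp add: isCont_iff add g0)
  qed
  obtain d where d: "d > 0" "\<And>u. \<bar>u\<bar> < d \<Longrightarrow> norm (g u - 1) < 1/2"
    using cont[unfolded continuous_at_eps_delta, rule_format, of "1/2"]
    by (auto simp: dist_norm g0)
  \<comment> \<open>On \<open>[0, a]\<close> the function \<open>g\<close> stays within 1/2 of 1, so
    its integral \<open>I\<close> stays within \<open>a/2\<close> of \<open>a\<close>. Hence
    \<open>I\<close> is nonzero and may be divided by.\<close>
  define a where "a = min (d/2) 1"
  have a: "0 < a" "a \<le> 1" "a < d" using d(1) by (auto simp: a_def min_def)
  define I where "I = integral {0..a} g"
  have gI: "(g has_integral I) {0..a}"
    unfolding I_def by (intro integrable_integral integrable_continuous_interval cont')
  have "((\<lambda>u. g u - 1) has_integral I - a *\<^sub>R 1) {0..a}"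
    using has_integral_diff[OF gI has_integral_const_real[of "1::complex" 0 a]] a by simp
  then have "norm (I - a *\<^sub>R 1) \<le> 1/2 * measure lborel (cbox 0 a)"
    using a d(2) by (intro has_integral_bound) (auto simp: less_eq_real_def)
  with a have I0: "I \<noteq> 0" by (auto simp: norm_minus_commute)
  \<comment> \<open>Differentiating \<open>g s = (F (s + a) - F s) / I\<close> gives
    \<open>(g (s + a) - g s) / I\<close>, which is \<open>c * g s\<close> by the functional
    equation.\<close>
  define c where "c = (g a - 1) / I"
  have der: "(g has_vector_derivative c * g t) (at t)" for t
  proof -
    \<comment> \<open>An antiderivative near \<open>t\<close> is enough: for \<open>s\<close>
      between \<open>t - 1\<close> and \<open>t + 1\<close> and \<open>u\<close> in
      \<open>[0, a]\<close>, the bound \<open>a \<le> 1\<close> keeps \<open>s + u\<close> inside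
      the window.\<close>
    obtain F where F: "\<And>s. s \<in> {t-1..t+2} \<Longrightarrow>
        (F has_vector_derivative g s) (at s within {t-1..t+2})"
      by (rule antiderivative_continuous[OF cont']) blast
    have Fat: "(F has_vector_derivative g s) (at s)" if "s \<in> {t-1<..<t+2}" for s
    proof -
      have "at s within {t-1..t+2} = at s"
        using that by (intro at_within_interior) auto
      with F[of s] that show ?thesis by auto
    qed
    have avg: "g s = (F (s + a) - F s) / I" if "s \<in> {t-1<..<t+1}" for s
    proof -
      have "((\<lambda>u. g (s + u)) has_integral F (s + a) - F (s + 0)) {0..a}"
      proof (rule fundamental_theorem_of_calculus)
        show "((\<lambda>u. F (s + u)) has_vector_derivative g (s + u)) (at u within {0..a})"
          if "u \<in> {0..a}" for u
        proof -
          have "(F has_vector_derivative g (s + u)) (at (s + u))"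
            using that a \<open>s \<in> _\<close> by (intro Fat) auto
          then have "((F \<circ> (\<lambda>u. s + u)) has_vector_derivative 1 *\<^sub>R g (s + u)) (at u)"
            by (intro vector_diff_chain_at) (auto intro!: derivative_eq_intros)
          then show ?thesis by (simp add: o_def has_vector_derivative_at_within)
        qed
      qed (use a in auto)
      moreover have "((\<lambda>u. g (s + u)) has_integral g s * I) {0..a}"
        unfolding add by (rule has_integral_mult_right[OF gI])
      ultimately have "F (s + a) - F (s + 0) = g s * I"
        by (rule has_integral_unique)
      then show ?thesis using I0 by (simp add: eq_divide_eq)
    qed
    have "((F \<circ> (\<lambda>s. s + a)) has_vector_derivative 1 *\<^sub>R g (t + a)) (at t)"
      using a by (intro vector_diff_chain_at Fat) (auto intro!: derivative_eq_intros)
    then have 1: "((\<lambda>s. F (s + a)) has_vector_derivative g (t + a)) (at t)"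
      by (simp add: o_def)
    have 2: "(F has_vector_derivative g t) (at t)" by (rule Fat) auto
    have "((\<lambda>s. (F (s + a) - F s) / I) has_vector_derivative (g (t + a) - g t) / I) (at t)"
      by (intro has_vector_derivative_divide has_vector_derivative_diff 1 2)
    also have "(g (t + a) - g t) / I = c * g t"
      by (simp add: add c_def field_simps)
    finally show ?thesis
      by (rule has_vector_derivative_transform_within_open[where S = "{t-1<..<t+1}"])
         (auto simp: avg)
  qed
  have "((\<lambda>t. g t * exp (of_real t * (- c))) has_vector_derivative 0) (at t)" for t
    using has_vector_derivative_mult[OF der exp_of_real_mult_has_vector_derivative[of "- c"], of t]
    by (simp add: algebra_simps)
  then obtain k where k: "g t * exp (of_real t * (- c)) = k" for t
    using has_vector_derivative_zero_constant[of UNIV "\<lambda>t. g t * exp (of_real t * (- c))"] by auto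
  have "k = 1" using k[of 0] by (simp add: g0)
  then have "g t = exp (of_real t * c)" for t
    using k[of t] by (simp add: exp_minus field_simps)
  then show ?thesis by (rule that)
qed

text \<open>The reciprocals of the roots have \<open>coeff q 1\<^sup>2 - 2 * coeff q 2\<close> as the sum of their squares.\<close>

lemma norm_coeff_roots_bound:
  fixes q :: "complex poly"
  assumes "coeff q 0 = 1" and "R \<ge> 0" and "\<And>t. cmod t * R < 1 \<Longrightarrow> poly q t \<noteq> 0"
  shows "cmod ((coeff q 1)\<^sup>2 - 2 * coeff q 2) \<le> real (degree q) * R\<^sup>2"
  using assms
proof (induction "degree q" arbitrary: q)
  case 0
  then show ?case by (simp add: coeff_eq_0)
next
  case (Suc n)
  then have "\<not> constant (poly q)"
    by (simp add: constant_degree)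
  then obtain a where a: "poly q a = 0"
    using fundamental_theorem_of_algebra by blast
  have a0: "a \<noteq> 0" using a Suc.prems(1) by (auto simp: poly_0_coeff_0)
  \<comment> \<open>The root \<open>a\<close> contributes the factor \<open>1 + s t\<close>,
    normalised so that the cofactor \<open>r\<close> again has constant term 1. This factor adds
    exactly the square of \<open>s\<close> to the quantity being bounded, so the sign of
    \<open>s\<close> is harmless.\<close>
  define s where "s = - 1 / a"
  have "[:- a, 1:] dvd q" using a by (simp add: poly_eq_0_iff_dvd)
  then obtain r' where r': "q = [:- a, 1:] * r'" by (elim dvdE)
  define r where "r = smult (- a) r'"
  have q: "q = [:1, s:] * r"
    unfolding r' r_def s_def using a0 by (simp add: smult_add_right)
  have r0: "coeff r 0 = 1" using Suc.prems(1) by (simp add: q)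
  have rn0: "r \<noteq> 0" using r0 by auto
  have s0: "s \<noteq> 0" using a0 by (simp add: s_def)
  have deg: "degree q = Suc (degree r)"
    unfolding q using rn0 s0 by (subst degree_mult_eq) auto
  have "cmod ((coeff r 1)\<^sup>2 - 2 * coeff r 2) \<le> real (degree r) * R\<^sup>2"
  proof (rule Suc.hyps(1))
    show "n = degree r" using deg Suc.hyps(2) by simp
    show "poly r t \<noteq> 0" if "cmod t * R < 1" for t
      using Suc.prems(3)[OF that] by (auto simp: q)
  qed (use r0 Suc.prems in auto)
  moreover have "cmod s \<le> R"
  proof -
    have "1 \<le> cmod a * R" using Suc.prems(3)[of a] a by force
    then show ?thesis using a0 by (simp add: s_def norm_divide field_simps)
  qed
  then have "(cmod s)\<^sup>2 \<le> R\<^sup>2" by (intro power_mono) auto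
  moreover have c: "coeff q 1 = coeff r 1 + s" "coeff q 2 = coeff r 2 + s * coeff r 1"
    using r0 by (simp_all add: q numeral_2_eq_2)
  have "(coeff q 1)\<^sup>2 - 2 * coeff q 2 = ((coeff r 1)\<^sup>2 - 2 * coeff r 2) + s\<^sup>2"
    unfolding c by (simp add: power2_eq_square algebra_simps)
  then have "cmod ((coeff q 1)\<^sup>2 - 2 * coeff q 2) \<le> cmod ((coeff r 1)\<^sup>2 - 2 * coeff r 2) + (cmod s)\<^sup>2"
    using norm_triangle_ineq[of "(coeff r 1)\<^sup>2 - 2 * coeff r 2" "s\<^sup>2"] by (simp add: norm_power)
  ultimately show ?case by (simp add: deg algebra_simps)
qed

text \<open>On the triangle \<open>i + j < n\<close> the binomial theorem collapses each diagonal;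
  the rest of the square is the remainder. The sequence \<open>p\<close> is general because the
  lemma serves both Jordan powers and the real powers of norms that dominate them.\<close>

lemma sum_exp_coeffs_square_triangle:
  fixes p :: "nat \<Rightarrow> 'b::real_vector" and s t :: real
  shows "(\<Sum>i<n. \<Sum>j<n. (s ^ i / fact i * (t ^ j / fact j)) *\<^sub>R p (i + j)) =
    (\<Sum>k<n. ((s + t) ^ k / fact k) *\<^sub>R p k) +
    (\<Sum>(i, j)\<in>{..<n} \<times> {..<n} - {(i, j). i + j < n}. (s ^ i / fact i * (t ^ j / fact j)) *\<^sub>R p (i + j))"
proof -
  let ?g = "\<lambda>i j. (s ^ i / fact i * (t ^ j / fact j)) *\<^sub>R p (i + j)"
  have "(\<Sum>k<n. ((s + t) ^ k / fact k) *\<^sub>R p k) = (\<Sum>k<n. \<Sum>i\<le>k. ?g i (k - i))"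
  proof (rule sum.cong[OF refl])
    fix k
    have "(s + t) ^ k / fact k = (\<Sum>i\<le>k. s ^ i / fact i * (t ^ (k - i) / fact (k - i)))"
      using exp_series_add_commuting[of s t k] by (simp add: mult.commute divide_inverse)
    then show "((s + t) ^ k / fact k) *\<^sub>R p k = (\<Sum>i\<le>k. ?g i (k - i))"
      by (simp add: scaleR_sum_left)
  qed
  also have "\<dots> = (\<Sum>(i, j)\<in>{(i, j). i + j < n}. ?g i j)"
    by (rule sum.triangle_reindex[symmetric])
  finally have "(\<Sum>k<n. ((s + t) ^ k / fact k) *\<^sub>R p k) = (\<Sum>(i, j)\<in>{(i, j). i + j < n}. ?g i j)" .
  moreover have "(\<Sum>i<n. \<Sum>j<n. ?g i j) = (\<Sum>(i, j)\<in>{..<n} \<times> {..<n}. ?g i j)"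
    by (rule sum.cartesian_product)
  moreover have "(\<Sum>(i, j)\<in>{..<n} \<times> {..<n}. ?g i j) =
      (\<Sum>(i, j)\<in>{..<n} \<times> {..<n} - {(i, j). i + j < n}. ?g i j) + (\<Sum>(i, j)\<in>{(i, j). i + j < n}. ?g i j)"
    by (rule sum.subset_diff) auto
  ultimately show ?thesis by (simp add: add.commute)
qed

section \<open>Power-associativity and the Jordan exponential\<close>

context unital_jordan_banach_algebra
begin

abbreviation jpow :: "'a \<Rightarrow> nat \<Rightarrow> 'a" where "jpow \<equiv> jpower jprod unit"
abbreviation E :: "'a \<Rightarrow> 'a" where "E \<equiv> jexp jprod unit"
abbreviation jinv :: "'a \<Rightarrow> bool" where "jinv \<equiv> jinvertible jprod unit"

lemma jprod_scaleC_right: "a \<bullet>\<^sub>J (c *\<^sub>C b) = c *\<^sub>C (a \<bullet>\<^sub>J b)"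
  using linear_right[of a] by (simp add: Vector_Spaces.linear_iff)

lemma jprod_scaleC_left: "(c *\<^sub>C a) \<bullet>\<^sub>J b = c *\<^sub>C (a \<bullet>\<^sub>J b)"
  using linear_left[of b] by (simp add: Vector_Spaces.linear_iff)

sublocale jprod: bounded_bilinear jprod
proof
  show "(a + a') \<bullet>\<^sub>J b = a \<bullet>\<^sub>J b + a' \<bullet>\<^sub>J b" for a a' b
    using linear_left[of b] by (simp add: Vector_Spaces.linear_iff)
  show "a \<bullet>\<^sub>J (b + b') = a \<bullet>\<^sub>J b + a \<bullet>\<^sub>J b'" for a b b'
    using linear_right[of a] by (simp add: Vector_Spaces.linear_iff)
  show "(r *\<^sub>R a) \<bullet>\<^sub>J b = r *\<^sub>R (a \<bullet>\<^sub>J b)" for r a b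
    by (simp add: jprod_scaleC_left flip: scaleC_of_real)
  show "a \<bullet>\<^sub>J (r *\<^sub>R b) = r *\<^sub>R (a \<bullet>\<^sub>J b)" for r a b
    by (simp add: jprod_scaleC_right flip: scaleC_of_real)
  show "\<exists>K. \<forall>a b. norm (a \<bullet>\<^sub>J b) \<le> norm a * norm b * K"
    by (rule exI[of _ 1]) (simp add: norm_jprod)
qed

lemma bounded_linear_scaleC: "bounded_linear (\<lambda>x. c *\<^sub>C x)"
proof (rule bounded_linear_intro[where K = "cmod c"])
  show "c *\<^sub>C (r *\<^sub>R x) = r *\<^sub>R (c *\<^sub>C x)" for r x
    by (simp add: mult.commute flip: scaleC_of_real)
qed (simp_all add: scale_right_distrib norm_scaleC mult.commute)

lemma bounded_linear_scaleC_left: "bounded_linear (\<lambda>c. c *\<^sub>C x)"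
  by (rule bounded_linear_intro[where K = "norm x"])
     (simp_all add: scale_left_distrib norm_scaleC scaleR_conv_of_real flip: scaleC_of_real)

lemma unit_right: "a \<bullet>\<^sub>J \<one>\<^sub>J = a"
  by (simp add: jprod_commute[of a] unit_left)

text \<open>The defect \<open>T\<close> of the Jordan identity is cubic in \<open>a\<close>.
  Inclusion-exclusion over \<open>a\<close>, \<open>c\<close>, \<open>d\<close> extracts its
  trilinear part, where commutativity makes every term occur twice.\<close>

lemma jordan_identity_linearized:
  "((a \<bullet>\<^sub>J c) \<bullet>\<^sub>J b) \<bullet>\<^sub>J d + ((c \<bullet>\<^sub>J d) \<bullet>\<^sub>J b) \<bullet>\<^sub>J a + ((d \<bullet>\<^sub>J a) \<bullet>\<^sub>J b) \<bullet>\<^sub>J c =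
   (a \<bullet>\<^sub>J c) \<bullet>\<^sub>J (b \<bullet>\<^sub>J d) + (c \<bullet>\<^sub>J d) \<bullet>\<^sub>J (b \<bullet>\<^sub>J a) + (d \<bullet>\<^sub>J a) \<bullet>\<^sub>J (b \<bullet>\<^sub>J c)"
  (is "?l = ?r")
proof -
  define T where "T = (\<lambda>a. ((a \<bullet>\<^sub>J a) \<bullet>\<^sub>J b) \<bullet>\<^sub>J a - (a \<bullet>\<^sub>J b) \<bullet>\<^sub>J (a \<bullet>\<^sub>J a))"
  have T: "T a = 0" for a by (simp add: T_def jordan_identity)
  have "T (a + c + d) - T (a + c) - T (c + d) - T (a + d) + T a + T c + T d = 2 *\<^sub>R (?l - ?r)"
    unfolding T_def scaleR_2
    by (simp add: jprod.add_left jprod.add_right jprod_commute algebra_simps)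
  then show ?thesis by (simp add: T)
qed

text \<open>The linearized identity writes multiplication by the power \<open>n + 2\<close> of
  \<open>x\<close> through multiplications by \<open>x\<close>, its square and its powers
  \<open>n\<close> and \<open>n + 1\<close>. These commute with multiplication by \<open>x\<close>:
  the square by the Jordan identity, the two powers by induction.\<close>

lemma jpow_mult_arg: "jpow x n \<bullet>\<^sub>J (x \<bullet>\<^sub>J z) = x \<bullet>\<^sub>J (jpow x n \<bullet>\<^sub>J z)"
proof (induction n arbitrary: z rule: induct_nat_012)
  case (ge2 n)
  have L: "jpow x (Suc (Suc n)) \<bullet>\<^sub>J z = 2 *\<^sub>R (jpow x (Suc n) \<bullet>\<^sub>J (x \<bullet>\<^sub>J z)) + (x \<bullet>\<^sub>J x) \<bullet>\<^sub>J (jpow x n \<bullet>\<^sub>J z)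
      - x \<bullet>\<^sub>J (x \<bullet>\<^sub>J (jpow x n \<bullet>\<^sub>J z)) - jpow x n \<bullet>\<^sub>J (x \<bullet>\<^sub>J (x \<bullet>\<^sub>J z))" for z
    using jordan_identity_linearized[of x "jpow x n" x z]
    by (simp add: jprod_commute algebra_simps scaleR_2)
  have sq: "(x \<bullet>\<^sub>J x) \<bullet>\<^sub>J (x \<bullet>\<^sub>J z) = x \<bullet>\<^sub>J ((x \<bullet>\<^sub>J x) \<bullet>\<^sub>J z)" for z
    using jordan_identity[of x z] by (metis jprod_commute)
  show ?case
    unfolding L by (simp only: ge2 sq jprod.add_right jprod.diff_right jprod.scaleR_right)
qed (simp_all add: unit_left unit_right)

lemma jpow_add: "jpow x m \<bullet>\<^sub>J jpow x n = jpow x (m + n)"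
  by (induction n) (simp_all add: unit_right jpow_mult_arg)

text \<open>The norm of the unit may differ from 1, so it stays in the bound.\<close>

lemma norm_jpow_le: "norm (jpow x n) \<le> norm \<one>\<^sub>J * norm x ^ n"
proof (induction n)
  case (Suc n)
  have "norm (x \<bullet>\<^sub>J jpow x n) \<le> norm x * norm (jpow x n)" by (rule norm_jprod)
  also have "\<dots> \<le> norm x * (norm \<one>\<^sub>J * norm x ^ n)" by (intro mult_left_mono Suc) simp
  finally show ?case by (simp add: algebra_simps)
qed simp

lemma jpow_scaleC: "jpow (c *\<^sub>C x) n = c ^ n *\<^sub>C jpow x n"
  by (induction n) (simp_all add: jprod_scaleC_left jprod_scaleC_right)

lemma jpow_scaleR: "jpow (t *\<^sub>R x) n = t ^ n *\<^sub>R jpow x n"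
  by (simp add: jpow_scaleC flip: scaleC_of_real)

lemma summable_norm_jexp: "summable (\<lambda>n. norm (jpow x n /\<^sub>R fact n))"
proof (rule summable_comparison_test')
  show "summable (\<lambda>n. norm \<one>\<^sub>J * (norm x ^ n /\<^sub>R fact n))"
    by (intro summable_mult summable_exp_generic)
  show "norm (norm (jpow x n /\<^sub>R fact n)) \<le> norm \<one>\<^sub>J * (norm x ^ n /\<^sub>R fact n)" for n
    using norm_jpow_le[of x n] by (simp add: field_simps)
qed

lemma jexp_sums: "(\<lambda>n. jpow x n /\<^sub>R fact n) sums E x"
  unfolding jexp_def by (rule summable_sums[OF summable_norm_cancel[OF summable_norm_jexp]])

lemma jexp_0: "E 0 = \<one>\<^sub>J"
proof -
  have "(\<lambda>n. jpow 0 n /\<^sub>R fact n) sums (jpow 0 0 /\<^sub>R fact 0)"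
    by (rule sums_finite[of "{0}", simplified]) (auto simp: gr0_conv_Suc jprod.zero_left)
  with jexp_sums[of 0] show ?thesis using sums_unique2 by fastforce
qed

lemma jexp_scaleC_unit: "E (c *\<^sub>C \<one>\<^sub>J) = exp c *\<^sub>C \<one>\<^sub>J"
proof -
  have 1: "jpow \<one>\<^sub>J n = \<one>\<^sub>J" for n by (induction n) (simp_all add: unit_left)
  have "(\<lambda>n. (c ^ n /\<^sub>R fact n) *\<^sub>C \<one>\<^sub>J) sums (exp c *\<^sub>C \<one>\<^sub>J)"
    by (intro bounded_linear.sums[OF bounded_linear_scaleC_left] exp_converges)
  moreover have "(c ^ n /\<^sub>R fact n) *\<^sub>C \<one>\<^sub>J = jpow (c *\<^sub>C \<one>\<^sub>J) n /\<^sub>R fact n" for n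
    by (simp add: jpow_scaleC 1 scaleR_conv_of_real flip: scaleC_of_real)
  ultimately show ?thesis using jexp_sums[of "c *\<^sub>C \<one>\<^sub>J"] sums_unique2 by auto
qed

text \<open>Power-associativity turns the product of partial sums into a double sum over powers of
  the single element \<open>x\<close>. The part \<open>D\<close> outside the triangle is dominated
  by a multiple of \<open>R\<close>, the same remainder for real exponentials, which tends to
  0.\<close>

lemma jexp_scaleR_add: "E (s *\<^sub>R x) \<bullet>\<^sub>J E (t *\<^sub>R x) = E ((s + t) *\<^sub>R x)"
proof -
  have sm: "(\<lambda>n. \<Sum>i<n. (s ^ i / fact i) *\<^sub>R jpow x i) \<longlonglongrightarrow> E (s *\<^sub>R x)" for s
    using jexp_sums[of "s *\<^sub>R x"] by (simp add: sums_def jpow_scaleR divide_inverse mult.commute)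
  have sr: "(\<lambda>n. \<Sum>i<n. (s ^ i / fact i) * r ^ i) \<longlonglongrightarrow> exp (s * r)" for s r :: real
    using exp_converges[of "s * r"] by (simp add: sums_def power_mult_distrib divide_inverse ac_simps)
  define Q where "Q n = {..<n} \<times> {..<n} - {(i, j). i + j < n}" for n :: nat
  define D where "D n = (\<Sum>(i, j)\<in>Q n. (s ^ i / fact i * (t ^ j / fact j)) *\<^sub>R jpow x (i + j))" for n
  define R where "R n = (\<Sum>(i, j)\<in>Q n. (\<bar>s\<bar> ^ i / fact i * (\<bar>t\<bar> ^ j / fact j)) *\<^sub>R norm x ^ (i + j))" for n
  have prod: "(\<Sum>i<n. (s ^ i / fact i) *\<^sub>R jpow x i) \<bullet>\<^sub>J (\<Sum>j<n. (t ^ j / fact j) *\<^sub>R jpow x j) =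
      (\<Sum>i<n. \<Sum>j<n. (s ^ i / fact i * (t ^ j / fact j)) *\<^sub>R jpow x (i + j))" for n
    by (simp only: jprod.sum_left)
       (simp add: jprod.sum_right jprod.scaleR_left jprod.scaleR_right jpow_add scaleR_sum_right mult.commute)
  have D: "D n = (\<Sum>i<n. (s ^ i / fact i) *\<^sub>R jpow x i) \<bullet>\<^sub>J (\<Sum>j<n. (t ^ j / fact j) *\<^sub>R jpow x j)
      - (\<Sum>k<n. ((s + t) ^ k / fact k) *\<^sub>R jpow x k)" for n
    using sum_exp_coeffs_square_triangle[where p = "jpow x" and s = s and t = t and n = n]
    unfolding prod D_def Q_def by simp
  have R: "R n = (\<Sum>i<n. (\<bar>s\<bar> ^ i / fact i) * norm x ^ i) * (\<Sum>j<n. (\<bar>t\<bar> ^ j / fact j) * norm x ^ j)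
      - (\<Sum>k<n. ((\<bar>s\<bar> + \<bar>t\<bar>) ^ k / fact k) * norm x ^ k)" for n
    using sum_exp_coeffs_square_triangle[where p = "\<lambda>k. norm x ^ k" and s = "\<bar>s\<bar>" and t = "\<bar>t\<bar>" and n = n]
    by (simp add: R_def Q_def sum_product power_add algebra_simps)
  have "R \<longlonglongrightarrow> exp (\<bar>s\<bar> * norm x) * exp (\<bar>t\<bar> * norm x) - exp ((\<bar>s\<bar> + \<bar>t\<bar>) * norm x)"
    unfolding R by (intro tendsto_intros sr)
  then have "R \<longlonglongrightarrow> 0" by (simp add: mult_exp_exp algebra_simps)
  then have lim: "(\<lambda>n. norm \<one>\<^sub>J * R n) \<longlonglongrightarrow> norm \<one>\<^sub>J * 0" by (rule tendsto_mult_left)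
  have le: "norm ((s ^ i / fact i * (t ^ j / fact j)) *\<^sub>R jpow x (i + j)) \<le>
      norm \<one>\<^sub>J * ((\<bar>s\<bar> ^ i / fact i * (\<bar>t\<bar> ^ j / fact j)) *\<^sub>R norm x ^ (i + j))" for i j
  proof -
    let ?k = "\<bar>s\<bar> ^ i / fact i * (\<bar>t\<bar> ^ j / fact j)"
    have "norm ((s ^ i / fact i * (t ^ j / fact j)) *\<^sub>R jpow x (i + j)) = ?k * norm (jpow x (i + j))"
      by (simp add: abs_mult power_abs)
    also have "\<dots> \<le> ?k * (norm \<one>\<^sub>J * norm x ^ (i + j))"
      by (intro mult_left_mono norm_jpow_le) simp
    also have "\<dots> = norm \<one>\<^sub>J * (?k *\<^sub>R norm x ^ (i + j))"
      by (simp only: real_scaleR_def mult.left_commute)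
    finally show ?thesis .
  qed
  have "norm (D n) \<le> norm \<one>\<^sub>J * R n" for n
    unfolding D_def R_def sum_distrib_left
    by (rule sum_norm_le) (simp only: split_beta le)
  with lim have "D \<longlonglongrightarrow> 0"
    by (intro Lim_null_comparison[of D "\<lambda>n. norm \<one>\<^sub>J * R n"]) auto
  moreover have "D \<longlonglongrightarrow> E (s *\<^sub>R x) \<bullet>\<^sub>J E (t *\<^sub>R x) - E ((s + t) *\<^sub>R x)"
    unfolding D by (intro tendsto_diff jprod.tendsto sm)
  ultimately show ?thesis using LIMSEQ_unique by fastforce
qed

lemma jexp_has_vector_derivative_0: "((\<lambda>t. E (t *\<^sub>R x)) has_vector_derivative x) (at 0)"
proof -
  \<comment> \<open>The series from its quadratic term on: for \<open>\<bar>t\<bar> \<le> 1\<close>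
    higher powers of \<open>t\<close> only shrink the terms, so the first-order remainder is at most
    \<open>t * t * M\<close>.\<close>
  define b where "b n = jpow x (n + 2) /\<^sub>R fact (n + 2)" for n
  define M where "M = (\<Sum>n. norm (b n))"
  have sb: "summable (\<lambda>n. norm (b n))"
    unfolding b_def by (rule summable_ignore_initial_segment[OF summable_norm_jexp])
  have bound: "norm (E (t *\<^sub>R x) - \<one>\<^sub>J - t *\<^sub>R x) \<le> t\<^sup>2 * M" if "\<bar>t\<bar> \<le> 1" for t
  proof -
    have "(\<lambda>n. jpow (t *\<^sub>R x) (n + 2) /\<^sub>R fact (n + 2)) sums
        (E (t *\<^sub>R x) - (\<Sum>i<2. jpow (t *\<^sub>R x) i /\<^sub>R fact i))"
      by (rule sums_split_initial_segment[OF jexp_sums])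
    then have s: "(\<lambda>n. t ^ (n + 2) *\<^sub>R b n) sums (E (t *\<^sub>R x) - \<one>\<^sub>J - t *\<^sub>R x)"
      by (simp add: numeral_2_eq_2 b_def jpow_scaleR unit_right mult.commute algebra_simps del: jpower.simps(2))
         (simp add: unit_right algebra_simps)
    have le: "norm (t ^ (n + 2) *\<^sub>R b n) \<le> t\<^sup>2 * norm (b n)" for n
    proof -
      have "norm (t ^ (n + 2) *\<^sub>R b n) = \<bar>t\<bar> ^ n * (t\<^sup>2 * norm (b n))"
        unfolding power_add by (simp add: abs_mult power_abs del: power2_eq_square)
      also have "\<dots> \<le> 1 * (t\<^sup>2 * norm (b n))"
        using that by (intro mult_right_mono power_le_one) auto
      finally show ?thesis by simp
    qed
    have "norm (\<Sum>n. t ^ (n + 2) *\<^sub>R b n) \<le> (\<Sum>n. t\<^sup>2 * norm (b n))"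
      by (rule norm_suminf_le[OF le summable_mult[OF sb]])
    then show ?thesis using sums_unique[OF s] suminf_mult[OF sb, of "t\<^sup>2"] by (simp add: M_def)
  qed
  show ?thesis
    unfolding has_vector_derivative_def has_derivative_at
  proof
    show "bounded_linear (\<lambda>t. t *\<^sub>R x)" by (rule bounded_linear_scaleR_left)
    show "(\<lambda>h. norm (E ((0 + h) *\<^sub>R x) - E (0 *\<^sub>R x) - h *\<^sub>R x) / norm h) \<midarrow>0\<rightarrow> 0"
    proof (rule Lim_null_comparison)
      show "((\<lambda>h. \<bar>h\<bar> * M) \<longlongrightarrow> 0) (at 0)"
        by (intro tendsto_eq_intros) auto
      have "\<forall>\<^sub>F h in at 0. \<bar>h::real\<bar> < 1 \<and> h \<noteq> 0"
        unfolding eventually_at by (intro exI[of _ 1]) auto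
      then show "\<forall>\<^sub>F h in at 0. norm (norm (E ((0 + h) *\<^sub>R x) - E (0 *\<^sub>R x) - h *\<^sub>R x) / norm h) \<le> \<bar>h\<bar> * M"
        by eventually_elim (use bound in \<open>simp add: jexp_0 divide_le_eq power2_eq_square ac_simps\<close>)
    qed
  qed
qed

section \<open>Closed associative subalgebras, Neumann series and invertibility\<close>

text \<open>Closedness keeps sums of series inside, and commutativity is inherited, so the usual
  arguments for commutative Banach algebras work within such a set.\<close>

definition assoc_subalgebra :: "'a set \<Rightarrow> bool" where
  "assoc_subalgebra S \<longleftrightarrow> closed S \<and> subspace S \<and> \<one>\<^sub>J \<in> S \<and>
    (\<forall>a\<in>S. \<forall>b\<in>S. a \<bullet>\<^sub>J b \<in> S) \<and>
    (\<forall>a\<in>S. \<forall>b\<in>S. \<forall>c\<in>S. (a \<bullet>\<^sub>J b) \<bullet>\<^sub>J c = a \<bullet>\<^sub>J (b \<bullet>\<^sub>J c))"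

text \<open>Take the closed complex span of the powers of \<open>x\<close>. The fact
  \<open>sub\<close> acts as an induction rule: a condition that cuts out a closed subspace need
  only be checked on powers. Products and associativity are extended from powers to \<open>S\<close>
  one argument at a time.\<close>

lemma obtain_assoc_subalgebra:
  obtains S where "assoc_subalgebra S" "x \<in> S"
proof -
  define F where "F = {T. closed T \<and> subspace T \<and> range (jpow x) \<subseteq> T}"
  define S where "S = \<Inter>F"
  have sub: "S \<subseteq> T" if "closed T" "subspace T" "\<And>n. jpow x n \<in> T" for T
    using that by (auto simp: S_def F_def)
  have pow: "jpow x n \<in> S" for n by (auto simp: S_def F_def)
  have clS: "closed S" unfolding S_def F_def by (rule closed_Inter) auto
  have ssS: "subspace S" unfolding S_def F_def by (rule subspace_Inter) auto
  have cont: "continuous_on UNIV (\<lambda>b. a \<bullet>\<^sub>J b)" "continuous_on UNIV (\<lambda>a. a \<bullet>\<^sub>J b)" for a b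
    by (auto intro!: jprod.continuous_on continuous_intros)
  have mult: "a \<bullet>\<^sub>J b \<in> S" if "a \<in> S" "b \<in> S" for a b
  proof -
    have 1: "S \<subseteq> {b. jpow x n \<bullet>\<^sub>J b \<in> S}" for n
    proof (rule sub)
      show "closed {b. jpow x n \<bullet>\<^sub>J b \<in> S}"
        using closed_vimage[OF clS cont(1)] by (simp add: vimage_def)
      show "subspace {b. jpow x n \<bullet>\<^sub>J b \<in> S}"
        using ssS by (auto simp: subspace_def jprod.add_right jprod_scaleC_right jprod.zero_right)
    qed (simp add: jpow_add pow)
    have "S \<subseteq> {a. a \<bullet>\<^sub>J b \<in> S}"
    proof (rule sub)
      show "closed {a. a \<bullet>\<^sub>J b \<in> S}"
        using closed_vimage[OF clS cont(2)] by (simp add: vimage_def)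
      show "subspace {a. a \<bullet>\<^sub>J b \<in> S}"
        using ssS by (auto simp: subspace_def jprod.add_left jprod_scaleC_left jprod.zero_left)
    qed (use 1 that in blast)
    then show ?thesis using that by blast
  qed
  have assoc: "(a \<bullet>\<^sub>J b) \<bullet>\<^sub>J c = a \<bullet>\<^sub>J (b \<bullet>\<^sub>J c)" if "a \<in> S" "b \<in> S" "c \<in> S" for a b c
  proof -
    have 1: "S \<subseteq> {c. (jpow x m \<bullet>\<^sub>J jpow x n) \<bullet>\<^sub>J c = jpow x m \<bullet>\<^sub>J (jpow x n \<bullet>\<^sub>J c)}" for m n
    proof (rule sub)
      show "closed {c. (jpow x m \<bullet>\<^sub>J jpow x n) \<bullet>\<^sub>J c = jpow x m \<bullet>\<^sub>J (jpow x n \<bullet>\<^sub>J c)}"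
        by (intro closed_Collect_eq jprod.continuous_on continuous_intros)
    qed (auto simp: subspace_def jprod.add_right jprod_scaleC_right jprod.zero_right jpow_add add.assoc)
    have 2: "S \<subseteq> {b. (jpow x m \<bullet>\<^sub>J b) \<bullet>\<^sub>J c = jpow x m \<bullet>\<^sub>J (b \<bullet>\<^sub>J c)}" for m
    proof (rule sub)
      show "closed {b. (jpow x m \<bullet>\<^sub>J b) \<bullet>\<^sub>J c = jpow x m \<bullet>\<^sub>J (b \<bullet>\<^sub>J c)}"
        by (intro closed_Collect_eq jprod.continuous_on continuous_intros)
    qed (use 1 that in \<open>auto simp: subspace_def jprod.add_right jprod.add_left jprod_scaleC_right
          jprod_scaleC_left jprod.zero_right jprod.zero_left\<close>)
    have "S \<subseteq> {a. (a \<bullet>\<^sub>J b) \<bullet>\<^sub>J c = a \<bullet>\<^sub>J (b \<bullet>\<^sub>J c)}"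
    proof (rule sub)
      show "closed {a. (a \<bullet>\<^sub>J b) \<bullet>\<^sub>J c = a \<bullet>\<^sub>J (b \<bullet>\<^sub>J c)}"
        by (intro closed_Collect_eq jprod.continuous_on continuous_intros)
    qed (use 2 that in \<open>auto simp: subspace_def jprod.add_right jprod.add_left jprod_scaleC_right
          jprod_scaleC_left jprod.zero_right jprod.zero_left\<close>)
    then show ?thesis using that by blast
  qed
  have "assoc_subalgebra S"
    unfolding assoc_subalgebra_def using clS ssS mult assoc pow[of 0] by auto
  moreover have "x \<in> S" using pow[of 1] by (simp add: unit_right)
  ultimately show ?thesis by (rule that)
qed

text \<open>Associativity turns the second condition on a Jordan inverse into a consequence of the
  first.\<close>

lemma jinvI:
  assumes "assoc_subalgebra S" "a \<in> S" "b \<in> S" "a \<bullet>\<^sub>J b = \<one>\<^sub>J"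
  shows "jinv a"
  unfolding jinvertible_def
  using assms by (intro exI[of _ b]) (auto simp: assoc_subalgebra_def unit_right)

context
  fixes S assumes S: "assoc_subalgebra S"
begin

lemma subalgebra_jprod: "a \<in> S \<Longrightarrow> b \<in> S \<Longrightarrow> a \<bullet>\<^sub>J b \<in> S"
  and subalgebra_assoc: "a \<in> S \<Longrightarrow> b \<in> S \<Longrightarrow> c \<in> S \<Longrightarrow> (a \<bullet>\<^sub>J b) \<bullet>\<^sub>J c = a \<bullet>\<^sub>J (b \<bullet>\<^sub>J c)"
  and subalgebra_unit: "\<one>\<^sub>J \<in> S"
  and subalgebra_scaleC: "a \<in> S \<Longrightarrow> z *\<^sub>C a \<in> S"
  and subalgebra_diff: "a \<in> S \<Longrightarrow> b \<in> S \<Longrightarrow> a - b \<in> S"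
  and subalgebra_sum: "(\<And>i. i \<in> I \<Longrightarrow> h i \<in> S) \<Longrightarrow> sum h I \<in> S"
  using S by (auto simp: assoc_subalgebra_def subspace_scale subspace_diff intro: subspace_sum)

lemma subalgebra_scaleR: "a \<in> S \<Longrightarrow> r *\<^sub>R a \<in> S"
  by (simp add: subalgebra_scaleC flip: scaleC_of_real)

lemma subalgebra_jpow: "a \<in> S \<Longrightarrow> jpow a n \<in> S"
  by (induction n) (simp_all add: subalgebra_unit subalgebra_jprod)

lemma subalgebra_sums: "h sums l \<Longrightarrow> (\<And>n. h n \<in> S) \<Longrightarrow> l \<in> S"
  using S unfolding assoc_subalgebra_def sums_def
  by (intro closed_sequentially[of S "\<lambda>n. \<Sum>i<n. h i" l]) (auto intro!: subalgebra_sum)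

lemma subalgebra_jexp: "a \<in> S \<Longrightarrow> E a \<in> S"
  by (rule subalgebra_sums[OF jexp_sums]) (simp add: subalgebra_scaleR subalgebra_jpow)

lemma subalgebra_neumann:
  assumes "u \<in> S" "norm u < 1"
  obtains v where "v \<in> S" "(\<one>\<^sub>J - u) \<bullet>\<^sub>J v = \<one>\<^sub>J"
proof -
  have "summable (\<lambda>n. jpow u n)"
  proof (rule summable_comparison_test')
    show "summable (\<lambda>n. norm \<one>\<^sub>J * norm u ^ n)"
      using assms by (intro summable_mult summable_geometric) simp
  qed (rule norm_jpow_le)
  then have v: "(\<lambda>n. jpow u n) sums suminf (jpow u)" by (rule summable_sums)
  have "(\<lambda>n. (\<one>\<^sub>J - u) \<bullet>\<^sub>J jpow u n) sums ((\<one>\<^sub>J - u) \<bullet>\<^sub>J suminf (jpow u))"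
    by (rule bounded_linear.sums[OF jprod.bounded_linear_right v])
  moreover have "(\<lambda>n. jpow u n - jpow u (Suc n)) sums (jpow u 0 - 0)"
    by (rule telescope_sums'[OF summable_LIMSEQ_zero[OF \<open>summable _\<close>]])
  ultimately have "(\<one>\<^sub>J - u) \<bullet>\<^sub>J suminf (jpow u) = \<one>\<^sub>J"
    by (auto simp: jprod.diff_left unit_left dest: sums_unique2)
  moreover have "suminf (jpow u) \<in> S"
    by (rule subalgebra_sums[OF v]) (rule subalgebra_jpow[OF assms(1)])
  ultimately show ?thesis using that by blast
qed

lemma subalgebra_jpow_inverse:
  assumes "a \<in> S" "b \<in> S" "a \<bullet>\<^sub>J b = \<one>\<^sub>J"
  shows "jpow a n \<bullet>\<^sub>J jpow b n = \<one>\<^sub>J"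
proof (induction n)
  case (Suc n)
  have "(a \<bullet>\<^sub>J jpow a n) \<bullet>\<^sub>J (b \<bullet>\<^sub>J jpow b n) = a \<bullet>\<^sub>J (jpow a n \<bullet>\<^sub>J (jpow b n \<bullet>\<^sub>J b))"
    using assms by (simp add: subalgebra_assoc subalgebra_jprod subalgebra_jpow jprod_commute[of b])
  also have "\<dots> = a \<bullet>\<^sub>J ((jpow a n \<bullet>\<^sub>J jpow b n) \<bullet>\<^sub>J b)"
    using assms by (simp add: subalgebra_assoc subalgebra_jpow)
  finally show ?case by (simp add: Suc unit_left assms(3))
qed (simp add: unit_left)

end

text \<open>Factor out \<open>- c\<close> and invert the rest by a Neumann series. It follows that
  the spectrum lies in the disc of radius \<open>norm u\<close>.\<close>

lemma jinv_diff_scaleC_unit: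
  assumes "norm u < cmod c"
  shows "jinv (u - c *\<^sub>C \<one>\<^sub>J)"
proof -
  obtain S where S: "assoc_subalgebra S" "u \<in> S" by (rule obtain_assoc_subalgebra)
  have c0: "c \<noteq> 0" using assms by auto
  let ?u = "inverse c *\<^sub>C u"
  have "?u \<in> S" by (simp add: S subalgebra_scaleC)
  moreover have "norm ?u < 1" using assms c0 by (simp add: norm_scaleC norm_inverse norm_divide field_simps)
  ultimately obtain v where v: "v \<in> S" "(\<one>\<^sub>J - ?u) \<bullet>\<^sub>J v = \<one>\<^sub>J"
    by (rule subalgebra_neumann[OF S(1)])
  have "u - c *\<^sub>C \<one>\<^sub>J = (- c) *\<^sub>C (\<one>\<^sub>J - ?u)"
    using c0 by (simp add: scale_right_diff_distrib)
  then have "(u - c *\<^sub>C \<one>\<^sub>J) \<bullet>\<^sub>J ((- inverse c) *\<^sub>C v) = \<one>\<^sub>J"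
    using c0 v(2) by (simp only: jprod_scaleC_left jprod_scaleC_right) simp
  then show ?thesis
    using S v by (intro jinvI[of S _ "(- inverse c) *\<^sub>C v"])
      (auto intro!: subalgebra_diff subalgebra_scaleC subalgebra_unit simp del: scale_minus_left)
qed

lemma jpow_one_minus: "jpow (\<one>\<^sub>J - t *\<^sub>C x) n = (\<Sum>k\<le>n. (of_nat (n choose k) * (- t) ^ k) *\<^sub>C jpow x k)"
proof (induction n)
  case (Suc n)
  let ?c = "\<lambda>n k. of_nat (n choose k) * (- t) ^ k"
  have "jpow (\<one>\<^sub>J - t *\<^sub>C x) (Suc n) = (\<Sum>k\<le>n. ?c n k *\<^sub>C jpow x k) + (\<Sum>k\<le>n. ((- t) * ?c n k) *\<^sub>C jpow x (Suc k))"
    by (simp add: Suc jprod.diff_left unit_left jprod_scaleC_left jprod_scaleC_right jprod.sum_right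
        scale_sum_right sum_negf scale_right_diff_distrib sum_subtractf mult_ac)
  \<comment> \<open>The added term vanishes since \<open>n choose Suc n = 0\<close>; after an index
    shift both sums match for Pascal's rule.\<close>
  also have "(\<Sum>k\<le>n. ?c n k *\<^sub>C jpow x k) = (\<Sum>k\<le>Suc n. ?c n k *\<^sub>C jpow x k)"
    by simp
  also have "\<dots> = \<one>\<^sub>J + (\<Sum>k\<le>n. ?c n (Suc k) *\<^sub>C jpow x (Suc k))"
    by (simp add: sum.atMost_Suc_shift del: sum.atMost_Suc)
  also have "\<one>\<^sub>J + (\<Sum>k\<le>n. ?c n (Suc k) *\<^sub>C jpow x (Suc k)) + (\<Sum>k\<le>n. ((- t) * ?c n k) *\<^sub>C jpow x (Suc k))
     = \<one>\<^sub>J + (\<Sum>k\<le>n. ?c (Suc n) (Suc k) *\<^sub>C jpow x (Suc k))"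
    by (simp add: add.assoc algebra_simps flip: sum.distrib scale_left_distrib)
  also have "\<dots> = (\<Sum>k\<le>Suc n. ?c (Suc n) k *\<^sub>C jpow x k)"
    by (simp add: sum.atMost_Suc_shift del: sum.atMost_Suc)
  finally show ?case .
qed simp

end

text \<open>In quotient form, norm estimates pass to derivatives, and an element becomes a limit of
  combinations of exponentials.\<close>

lemma has_vector_derivative_quotient_tendsto:
  fixes h :: "real \<Rightarrow> 'b::real_normed_vector"
  assumes "(h has_vector_derivative D) (at 0)"
  shows "((\<lambda>t. (h t - h 0) /\<^sub>R t) \<longlongrightarrow> D) (at 0)"
proof -
  have "((\<lambda>t. norm (h t - h 0 - t *\<^sub>R D) / norm t) \<longlongrightarrow> 0) (at 0)"
    using assms unfolding has_vector_derivative_def has_derivative_at by simp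
  moreover have "\<forall>\<^sub>F t in at 0. norm (h t - h 0 - t *\<^sub>R D) / norm t = norm ((h t - h 0) /\<^sub>R t - D)"
    using eventually_neq_at_within[of 0 0 UNIV]
  proof eventually_elim
    case (elim t)
    then have "(h t - h 0) /\<^sub>R t - D = (h t - h 0 - t *\<^sub>R D) /\<^sub>R t"
      by (simp add: scaleR_diff_right)
    then show ?case by (simp add: divide_inverse mult.commute)
  qed
  ultimately have "((\<lambda>t. norm ((h t - h 0) /\<^sub>R t - D)) \<longlongrightarrow> 0) (at 0)"
    by (rule Lim_transform_eventually)
  then show ?thesis by (rule LIM_zero_cancel[OF tendsto_norm_zero_cancel])
qed

section \<open>The exponent of \<open>f\<close> along exponentials, with its linear and antilinear
  parts\<close>

locale multiplicative_spectral_functional = unital_jordan_banach_algebra scaleC jprod unit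
  for scaleC :: "complex \<Rightarrow> 'a::banach \<Rightarrow> 'a" (infixr "*\<^sub>C" 75)
    and jprod :: "'a \<Rightarrow> 'a \<Rightarrow> 'a" (infixl "\<bullet>\<^sub>J" 70)
    and unit :: 'a ("\<one>\<^sub>J") +
  fixes f :: "'a \<Rightarrow> complex"
  assumes f_spectrum: "f x \<in> jspectrum scaleC jprod unit x"
    and f_mult: "f (x \<bullet>\<^sub>J y) = f x * f y"
begin

lemma not_jinv_diff_f: "\<not> jinv (x - f x *\<^sub>C \<one>\<^sub>J)"
  using f_spectrum[of x] by (simp add: jspectrum_def)

text \<open>Shifting \<open>x\<close> by \<open>c\<close> times the unit shifts the spectral value
  by \<open>c\<close>, and spectral values are bounded by the norm.\<close>

lemma cmod_f_diff_le: "cmod (f x - c) \<le> norm (x - c *\<^sub>C \<one>\<^sub>J)"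
proof (rule ccontr)
  assume "\<not> ?thesis"
  then have "jinv (x - c *\<^sub>C \<one>\<^sub>J - (f x - c) *\<^sub>C \<one>\<^sub>J)"
    by (intro jinv_diff_scaleC_unit) simp
  then show False using not_jinv_diff_f[of x] by (simp add: scale_left_diff_distrib)
qed

lemma f_scaleC_unit: "f (c *\<^sub>C \<one>\<^sub>J) = c"
  using cmod_f_diff_le[of "c *\<^sub>C \<one>\<^sub>J" c] by simp

lemma f_unit: "f \<one>\<^sub>J = 1"
  using f_scaleC_unit[of 1] by simp

text \<open>Asking for all real \<open>t\<close> removes the ambiguity of the logarithm; existence
  comes from the one-parameter group \<open>f (E (t *\<^sub>R x))\<close>.\<close>

definition psi :: "'a \<Rightarrow> complex" where
  "psi x = (SOME c. \<forall>t. f (E (t *\<^sub>R x)) = exp (of_real t * c))"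

lemma f_jexp_scaleR: "f (E (t *\<^sub>R x)) = exp (of_real t * psi x)"
proof -
  have "\<exists>c. \<forall>t. f (E (t *\<^sub>R x)) = exp (of_real t * c)"
  proof (rule continuous_one_parameter_group[of "\<lambda>t. f (E (t *\<^sub>R x))"])
    show "f (E ((s + t) *\<^sub>R x)) = f (E (s *\<^sub>R x)) * f (E (t *\<^sub>R x))" for s t
      by (simp add: jexp_scaleR_add flip: f_mult)
    have "((\<lambda>t. E (t *\<^sub>R x) - \<one>\<^sub>J) \<longlongrightarrow> E (0 *\<^sub>R x) - \<one>\<^sub>J) (at 0)"
      using has_vector_derivative_continuous[OF jexp_has_vector_derivative_0]
      by (intro tendsto_intros) (simp add: continuous_within)
    then have "((\<lambda>t. norm (E (t *\<^sub>R x) - \<one>\<^sub>J)) \<longlongrightarrow> 0) (at 0)"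
      by (intro tendsto_norm_zero) (simp add: jexp_0)
    then have "((\<lambda>t. f (E (t *\<^sub>R x)) - 1) \<longlongrightarrow> 0) (at 0)"
      by (rule Lim_null_comparison[rotated]) (use cmod_f_diff_le[of _ 1] in simp)
    then show "isCont (\<lambda>t. f (E (t *\<^sub>R x))) 0"
      by (simp add: isCont_def jexp_0 f_unit LIM_zero_iff)
  qed (auto simp: jexp_0 f_unit)
  from someI_ex[OF this] show ?thesis unfolding psi_def by (rule spec)
qed

lemma psi_eqI: "(\<And>t. f (E (t *\<^sub>R x)) = exp (of_real t * c)) \<Longrightarrow> psi x = c"
  by (rule exp_of_real_mult_inject) (simp add: f_jexp_scaleR)

text \<open>Near the unit \<open>f\<close> is controlled by the distance to the unit, so difference
  quotients of \<open>f\<close> along \<open>h\<close> are bounded by those of \<open>h\<close>.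
  This yields both the bound on \<open>psi\<close> and, for a curve with derivative 0, its
  additivity.\<close>

lemma cmod_derivative_le:
  assumes "h 0 = \<one>\<^sub>J" "(h has_vector_derivative D) (at 0)"
    and d: "((\<lambda>t. f (h t)) has_vector_derivative d) (at 0)"
  shows "cmod d \<le> norm D"
proof (rule tendsto_le[of "at (0::real)"])
  show "((\<lambda>t. norm ((h t - h 0) /\<^sub>R t)) \<longlongrightarrow> norm D) (at 0)"
    by (intro tendsto_norm has_vector_derivative_quotient_tendsto assms)
  show "((\<lambda>t. norm ((f (h t) - f (h 0)) /\<^sub>R t)) \<longlongrightarrow> cmod d) (at 0)"
    by (intro tendsto_norm has_vector_derivative_quotient_tendsto[OF d])
  show "\<forall>\<^sub>F t in at 0. norm ((f (h t) - f (h 0)) /\<^sub>R t) \<le> norm ((h t - h 0) /\<^sub>R t)"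
    using cmod_f_diff_le[of _ 1] by (simp add: assms f_unit mult_left_mono)
qed simp

lemma cmod_psi_le: "cmod (psi x) \<le> norm x"
proof (rule cmod_derivative_le)
  show "((\<lambda>t. E (t *\<^sub>R x)) has_vector_derivative x) (at 0)"
    by (rule jexp_has_vector_derivative_0)
  show "((\<lambda>t. f (E (t *\<^sub>R x))) has_vector_derivative psi x) (at 0)"
    using exp_of_real_mult_has_vector_derivative[of "psi x" 0] by (simp add: f_jexp_scaleR)
qed (simp add: jexp_0)

lemma psi_add: "psi (x + y) = psi x + psi y"
proof -
  define h where "h t = E (t *\<^sub>R (- (x + y))) \<bullet>\<^sub>J (E (t *\<^sub>R x) \<bullet>\<^sub>J E (t *\<^sub>R y))" for t
  define d where "d = psi (- (x + y)) + (psi x + psi y)"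
  have "cmod d \<le> norm (0::'a)"
  proof (rule cmod_derivative_le)
    show "h 0 = \<one>\<^sub>J" by (simp add: h_def jexp_0 unit_left)
    have "(h has_vector_derivative
        (E (0 *\<^sub>R (- (x + y))) \<bullet>\<^sub>J (E (0 *\<^sub>R x) \<bullet>\<^sub>J y + x \<bullet>\<^sub>J E (0 *\<^sub>R y)) +
         (- (x + y)) \<bullet>\<^sub>J (E (0 *\<^sub>R x) \<bullet>\<^sub>J E (0 *\<^sub>R y)))) (at 0)"
      unfolding h_def
      by (intro jprod.has_vector_derivative jexp_has_vector_derivative_0)
    then show "(h has_vector_derivative 0) (at 0)"
      by (simp only: scaleR_zero_left jexp_0 unit_left unit_right) simp
    have "f (h t) = exp (of_real t * d)" for t
      by (simp add: h_def f_mult f_jexp_scaleR d_def exp_add distrib_left)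
    then show "((\<lambda>t. f (h t)) has_vector_derivative d) (at 0)"
      using exp_of_real_mult_has_vector_derivative[of d 0] by simp
  qed
  moreover have "psi (- z) = - psi z" for z
    using f_jexp_scaleR[of "- _" z] by (intro psi_eqI) simp
  ultimately have "- psi (x + y) + (psi x + psi y) = 0" by (simp only: d_def) simp
  then show ?thesis by (simp add: add_eq_0_iff2 flip: neg_eq_iff_add_eq_0)
qed

lemma psi_scaleR: "psi (r *\<^sub>R x) = of_real r * psi x"
  using f_jexp_scaleR[of "_ * r" x] by (intro psi_eqI) (simp add: mult.assoc)

lemma psi_scaleC_unit: "psi (c *\<^sub>C \<one>\<^sub>J) = c"
  by (intro psi_eqI)
     (simp add: jexp_scaleC_unit f_scaleC_unit flip: scaleC_of_real)

text \<open>If \<open>psi y = 0\<close>, then no \<open>E (s *\<^sub>R y) - \<one>\<^sub>J\<close> is invertible, although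
  \<open>(E (s *\<^sub>R y) - \<one>\<^sub>J) /\<^sub>R s\<close> tends to \<open>y\<close> within the associative subalgebra.\<close>

lemma psi_nonzero:
  assumes S: "assoc_subalgebra S" and y: "y \<in> S" and w: "w \<in> S" and yw: "y \<bullet>\<^sub>J w = \<one>\<^sub>J"
  shows "psi y \<noteq> 0"
proof
  assume 0: "psi y = 0"
  \<comment> \<open>The derivative of \<open>h\<close> at 0 is \<open>y \<bullet>\<^sub>J w\<close>,
    the unit. So for some nonzero \<open>s\<close> the quotient, which is
    \<open>e \<bullet>\<^sub>J w\<close> divided by \<open>s\<close>, is close enough to the unit
    for a Neumann series, and \<open>e\<close> gets an inverse.\<close>
  define h where "h s = E (s *\<^sub>R y) \<bullet>\<^sub>J w" for s
  have "(h has_vector_derivative (E (0 *\<^sub>R y) \<bullet>\<^sub>J 0 + y \<bullet>\<^sub>J w)) (at 0)"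
    unfolding h_def
    by (intro jprod.has_vector_derivative jexp_has_vector_derivative_0 has_vector_derivative_const)
  then have "(h has_vector_derivative \<one>\<^sub>J) (at 0)"
    by (simp add: yw jprod.zero_right)
  from has_vector_derivative_quotient_tendsto[OF this]
  have "\<forall>\<^sub>F s in at 0. dist ((h s - h 0) /\<^sub>R s) \<one>\<^sub>J < 1"
    by (rule tendstoD) simp
  then have "\<forall>\<^sub>F s in at 0. dist ((h s - h 0) /\<^sub>R s) \<one>\<^sub>J < 1 \<and> s \<noteq> 0"
    using eventually_neq_at_within by (rule eventually_conj)
  then obtain s where s: "dist ((h s - h 0) /\<^sub>R s) \<one>\<^sub>J < 1" "s \<noteq> 0"
    using eventually_happens' trivial_limit_at by blast
  define e where "e = E (s *\<^sub>R y) - \<one>\<^sub>J"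
  have e: "e \<in> S"
    unfolding e_def using S y
    by (intro subalgebra_diff subalgebra_jexp subalgebra_scaleR subalgebra_unit)
  have hs: "(h s - h 0) /\<^sub>R s = (e \<bullet>\<^sub>J w) /\<^sub>R s"
    by (simp add: h_def e_def jexp_0 jprod.diff_left)
  define u where "u = \<one>\<^sub>J - (e \<bullet>\<^sub>J w) /\<^sub>R s"
  have "u \<in> S"
    unfolding u_def using S e w
    by (intro subalgebra_diff subalgebra_scaleR subalgebra_unit subalgebra_jprod)
  moreover have "norm u < 1"
    using s(1) by (simp add: u_def hs dist_norm norm_minus_commute)
  ultimately obtain v where v: "v \<in> S" "(\<one>\<^sub>J - u) \<bullet>\<^sub>J v = \<one>\<^sub>J"
    by (rule subalgebra_neumann[OF S])
  have "e \<bullet>\<^sub>J ((w \<bullet>\<^sub>J v) /\<^sub>R s) = \<one>\<^sub>J"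
    using v(2) by (simp add: u_def jprod.scaleR_left jprod.scaleR_right subalgebra_assoc[OF S e w v(1)])
  then have "jinv e"
    using S e w v(1) by (intro jinvI[OF S e, of "(w \<bullet>\<^sub>J v) /\<^sub>R s"] subalgebra_scaleR subalgebra_jprod)
  \<comment> \<open>Hence 1 lies in the spectrum of \<open>E (s *\<^sub>R y)\<close>, contradicting
    the invertibility of \<open>e\<close>.\<close>
  moreover have "f (E (s *\<^sub>R y)) = 1"
    by (simp add: f_jexp_scaleR 0)
  ultimately show False
    using not_jinv_diff_f[of "E (s *\<^sub>R y)"] by (simp add: e_def)
qed

text \<open>\<open>psi = p1 + cnj \<circ> p2\<close> with complex-linear \<open>p1\<close> and \<open>p2\<close>; \<open>p2\<close> will turn out to vanish.\<close>

definition p1 :: "'a \<Rightarrow> complex" where "p1 x = (psi x - \<i> * psi (\<i> *\<^sub>C x)) / 2"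
definition p2 :: "'a \<Rightarrow> complex" where "p2 x = cnj ((psi x + \<i> * psi (\<i> *\<^sub>C x)) / 2)"

lemma psi_eq_p1_p2: "psi x = p1 x + cnj (p2 x)"
  by (simp add: p1_def p2_def field_simps)

lemma psi_scaleC: "psi (c *\<^sub>C x) = of_real (Re c) * psi x + of_real (Im c) * psi (\<i> *\<^sub>C x)"
proof -
  have "c *\<^sub>C x = Re c *\<^sub>R x + Im c *\<^sub>R (\<i> *\<^sub>C x)"
    by (subst complex_eq[of c]) (simp add: scale_left_distrib mult.commute del: Complex_eq flip: scaleC_of_real)
  then show ?thesis by (simp add: psi_add psi_scaleR)
qed

lemma p1_linear: "Vector_Spaces.linear scaleC (*) p1"
  unfolding Vector_Spaces.linear_iff
proof (intro conjI allI)
  fix x y c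
  show "p1 (x + y) = p1 x + p1 y"
    by (simp add: p1_def psi_add scale_right_distrib field_simps)
  show "p1 (c *\<^sub>C x) = c * p1 x"
    unfolding p1_def psi_scaleC[of c x] psi_scaleC[of "\<i> * c" x] scale_scale
    by (simp add: complex_eq_iff field_simps)
qed (unfold_locales, simp_all add: algebra_simps)

lemma p2_linear: "Vector_Spaces.linear scaleC (*) p2"
  unfolding Vector_Spaces.linear_iff
proof (intro conjI allI)
  fix x y c
  show "p2 (x + y) = p2 x + p2 y"
    by (simp add: p2_def psi_add scale_right_distrib field_simps)
  show "p2 (c *\<^sub>C x) = c * p2 x"
    unfolding p2_def psi_scaleC[of c x] psi_scaleC[of "\<i> * c" x] scale_scale
    by (simp add: complex_eq_iff field_simps)
qed (unfold_locales, simp_all add: algebra_simps)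

lemma p1_unit: "p1 \<one>\<^sub>J = 1" and p2_unit: "p2 \<one>\<^sub>J = 0"
  using psi_scaleC_unit[of 1] psi_scaleC_unit[of \<i>] by (simp_all add: p1_def p2_def)

text \<open>Every nonzero complex multiple of \<open>y\<close> has an inverse in \<open>S\<close>,
  so \<open>psi\<close> vanishes at none of them; with equal moduli some rotation of
  \<open>y\<close> would make the two parts of \<open>psi\<close> cancel.\<close>

lemma cmod_p1_neq_cmod_p2:
  assumes S: "assoc_subalgebra S" and y: "y \<in> S" and w: "w \<in> S" and yw: "y \<bullet>\<^sub>J w = \<one>\<^sub>J"
  shows "cmod (p1 y) \<noteq> cmod (p2 y)"
proof
  assume eq: "cmod (p1 y) = cmod (p2 y)"
  have nz: "c * p1 y + cnj (c * p2 y) \<noteq> 0" if "c \<noteq> 0" for c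
  proof -
    have "psi (c *\<^sub>C y) \<noteq> 0"
      using that S y w yw
      by (intro psi_nonzero[of S _ "inverse c *\<^sub>C w"])
         (auto intro: subalgebra_scaleC simp: jprod_scaleC_left jprod_scaleC_right)
    then show ?thesis
      using p1_linear p2_linear by (simp add: psi_eq_p1_p2 Vector_Spaces.linear_iff)
  qed
  have p1: "p1 y \<noteq> 0" using nz[of 1] eq by (cases "p1 y = 0") simp_all
  have p2: "p2 y \<noteq> 0" using p1 eq by (metis norm_eq_zero)
  \<comment> \<open>The radicand has modulus 1, so \<open>cnj c\<close> is the inverse of
    \<open>c\<close>, and \<open>c\<close> times \<open>psi (c *\<^sub>C y)\<close> becomes
    0.\<close>
  define c where "c = csqrt (- cnj (p2 y) / p1 y)"
  have c2: "c * c * p1 y = - cnj (p2 y)"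
    using p1 by (simp add: c_def flip: power2_eq_square)
  have "cmod (c\<^sup>2) = 1"
    using p1 eq p2 by (simp add: c_def norm_divide)
  then have "cmod c = 1" by (simp add: norm_power power2_eq_1_iff) (use norm_ge_zero[of c] in linarith)
  then have cc: "c * cnj c = 1" and c0: "c \<noteq> 0" by (auto simp: complex_norm_square[symmetric])
  have "c * (c * p1 y + cnj (c * p2 y)) = c * c * p1 y + (c * cnj c) * cnj (p2 y)"
    by (simp add: algebra_simps)
  then show False using nz[OF c0] c0 by (simp add: c2 cc)
qed

section \<open>Binomial polynomials and multiplicativity of \<open>psi\<close>\<close>

definition binomial_poly :: "('a \<Rightarrow> complex) \<Rightarrow> 'a \<Rightarrow> nat \<Rightarrow> complex poly" where
  "binomial_poly L x n = (\<Sum>k\<le>n. monom (of_nat (n choose k) * (- 1) ^ k * L (jpow x k)) k)"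

lemma poly_binomial_poly:
  assumes "Vector_Spaces.linear scaleC (*) L"
  shows "poly (binomial_poly L x n) t = L (jpow (\<one>\<^sub>J - t *\<^sub>C x) n)"
proof -
  interpret L: Vector_Spaces.linear scaleC "(*)" L by fact
  show ?thesis
    unfolding jpow_one_minus L.sum L.scale
    by (simp add: binomial_poly_def poly_sum poly_monom power_minus[of t] mult_ac)
qed

lemma coeff_binomial_poly:
  "k \<le> n \<Longrightarrow> coeff (binomial_poly L x n) k = of_nat (n choose k) * (- 1) ^ k * L (jpow x k)"
  by (simp add: binomial_poly_def coeff_sum sum.delta)

lemma degree_binomial_poly_le: "degree (binomial_poly L x n) \<le> n"
  unfolding binomial_poly_def
  by (rule degree_sum_le) (auto intro: order_trans[OF degree_monom_le])

text \<open>The root bound limits a combination of the first coefficients to linear growth in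
  \<open>n\<close>, whereas that combination has leading term \<open>D\<close> times the square of
  \<open>n\<close>. So \<open>D\<close> must be 0.\<close>

lemma linear_square_if_nonvanishing:
  assumes L: "Vector_Spaces.linear scaleC (*) L" and L1: "L \<one>\<^sub>J = 1"
    and nz: "\<And>t n. cmod t * norm x < 1 \<Longrightarrow> L (jpow (\<one>\<^sub>J - t *\<^sub>C x) n) \<noteq> 0"
  shows "L (x \<bullet>\<^sub>J x) = (L x)\<^sup>2"
proof (rule ccontr)
  define D where "D = (L x)\<^sup>2 - L (x \<bullet>\<^sub>J x)"
  define C where "C = (norm x)\<^sup>2 + cmod (L (x \<bullet>\<^sub>J x))"
  assume "L (x \<bullet>\<^sub>J x) \<noteq> (L x)\<^sup>2"
  then have D0: "cmod D > 0" by (simp add: D_def)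
  obtain m :: nat where m: "C / cmod D < real m" using reals_Archimedean2 by blast
  \<comment> \<open>The shift by 2 makes the coefficient of degree 2 available.\<close>
  define n where "n = m + 2"
  let ?q = "binomial_poly L x n"
  have ch: "2 * of_nat (n choose 2) = (of_nat n * (of_nat n - 1) :: complex)"
    by (induction n) (simp_all add: numeral_2_eq_2 algebra_simps)
  have "cmod ((coeff ?q 1)\<^sup>2 - 2 * coeff ?q 2) \<le> real (degree ?q) * (norm x)\<^sup>2"
  proof (rule norm_coeff_roots_bound)
    show "coeff ?q 0 = 1" by (simp add: coeff_binomial_poly L1)
  qed (simp_all add: poly_binomial_poly[OF L] nz)
  also have "\<dots> \<le> real n * (norm x)\<^sup>2"
    by (intro mult_right_mono) (simp_all add: degree_binomial_poly_le)
  also have "(coeff ?q 1)\<^sup>2 - 2 * coeff ?q 2 = (of_nat n)\<^sup>2 * (L x)\<^sup>2 - (2 * of_nat (n choose 2)) * L (x \<bullet>\<^sub>J x)"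
    by (simp add: coeff_binomial_poly n_def numeral_2_eq_2 unit_right power_mult_distrib del: binomial_Suc_Suc)
       (simp add: algebra_simps)
  also have "\<dots> = of_nat n * (of_nat n * D + L (x \<bullet>\<^sub>J x))"
    unfolding ch by (simp add: D_def power2_eq_square algebra_simps)
  finally have "real n * cmod (of_nat n * D + L (x \<bullet>\<^sub>J x)) \<le> real n * (norm x)\<^sup>2"
    by (simp add: norm_mult)
  then have "cmod (of_nat n * D + L (x \<bullet>\<^sub>J x)) \<le> (norm x)\<^sup>2"
    by (simp add: n_def)
  then have "real n * cmod D \<le> C"
    using norm_triangle_ineq4[of "of_nat n * D + L (x \<bullet>\<^sub>J x)" "L (x \<bullet>\<^sub>J x)"]
    by (simp add: C_def norm_mult)
  moreover have "C < real m * cmod D" using m D0 by (simp add: field_simps)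
  moreover have "real m * cmod D \<le> real n * cmod D" by (intro mult_right_mono) (simp_all add: n_def)
  ultimately show False by linarith
qed

text \<open>On the segment from 0 to \<open>t\<close> the difference of moduli starts at 1 and is
  never 0, because the powers involved have inverses in an associative subalgebra.\<close>

lemma cmod_p2_less_cmod_p1:
  assumes "cmod t * norm x < 1"
  shows "cmod (p2 (jpow (\<one>\<^sub>J - t *\<^sub>C x) n)) < cmod (p1 (jpow (\<one>\<^sub>J - t *\<^sub>C x) n))"
proof (rule ccontr)
  assume neg: "\<not> ?thesis"
  \<comment> \<open>Written through polynomials, \<open>g\<close> is visibly continuous in
    \<open>r\<close>.\<close>
  define g where "g r = cmod (poly (binomial_poly p1 x n) (of_real r * t)) -
    cmod (poly (binomial_poly p2 x n) (of_real r * t))" for r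
  have g: "g r = cmod (p1 (jpow (\<one>\<^sub>J - (of_real r * t) *\<^sub>C x) n)) - cmod (p2 (jpow (\<one>\<^sub>J - (of_real r * t) *\<^sub>C x) n))" for r
    by (simp add: g_def poly_binomial_poly p1_linear p2_linear)
  have one: "jpow \<one>\<^sub>J n = \<one>\<^sub>J" by (induction n) (simp_all add: unit_left)
  have "g 0 = 1" by (simp add: g one p1_unit p2_unit)
  moreover have "g 1 \<le> 0" using neg by (simp add: g)
  moreover have "continuous_on {0..1} g"
    unfolding g_def by (intro continuous_intros)
  ultimately obtain r where r: "0 \<le> r" "r \<le> 1" "g r = 0"
    using IVT2'[of g 1 0 0] by auto
  obtain S where S: "assoc_subalgebra S" "x \<in> S" by (rule obtain_assoc_subalgebra)
  let ?u = "(of_real r * t) *\<^sub>C x"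
  have u: "?u \<in> S" using S by (intro subalgebra_scaleC)
  have "norm ?u \<le> cmod t * norm x"
    using r by (simp add: norm_scaleC norm_mult mult.assoc mult_left_le_one_le)
  with assms have "norm ?u < 1" by simp
  then obtain v where v: "v \<in> S" "(\<one>\<^sub>J - ?u) \<bullet>\<^sub>J v = \<one>\<^sub>J"
    by (rule subalgebra_neumann[OF S(1) u])
  have y: "\<one>\<^sub>J - ?u \<in> S" using S u by (intro subalgebra_diff subalgebra_unit)
  show False
    using cmod_p1_neq_cmod_p2[OF S(1) subalgebra_jpow[OF S(1) y] subalgebra_jpow[OF S(1) v(1)]
        subalgebra_jpow_inverse[OF S(1) y v]] r(3) by (simp add: g)
qed

lemma p1_plus_p2_square:
  assumes "cmod c \<le> 1"
  shows "p1 (x \<bullet>\<^sub>J x) + c * p2 (x \<bullet>\<^sub>J x) = (p1 x + c * p2 x)\<^sup>2"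
proof (rule linear_square_if_nonvanishing[where L = "\<lambda>x. p1 x + c * p2 x"])
  show "Vector_Spaces.linear scaleC (*) (\<lambda>x. p1 x + c * p2 x)"
    using p1_linear p2_linear by (simp add: Vector_Spaces.linear_iff algebra_simps)
  show "p1 \<one>\<^sub>J + c * p2 \<one>\<^sub>J = 1" by (simp add: p1_unit p2_unit)
  fix t n assume "cmod t * norm x < 1"
  then have less: "cmod (p2 (jpow (\<one>\<^sub>J - t *\<^sub>C x) n)) < cmod (p1 (jpow (\<one>\<^sub>J - t *\<^sub>C x) n))"
    (is "cmod ?b < cmod ?a") by (rule cmod_p2_less_cmod_p1)
  have "cmod (c * ?b) \<le> cmod ?b" using assms by (simp add: norm_mult mult_left_le_one_le)
  with less show "?a + c * ?b \<noteq> 0" by (metis add_eq_0_iff2 leD norm_minus_cancel)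
qed

text \<open>Adding the square rules for \<open>c = 1\<close> and \<open>c = - 1\<close> and
  comparing with \<open>c = 0\<close> leaves only the square of \<open>p2 x\<close>.\<close>

lemma p2_eq_0: "p2 x = 0"
proof -
  have "2 * p1 (x \<bullet>\<^sub>J x) = (p1 x + p2 x)\<^sup>2 + (p1 x - p2 x)\<^sup>2"
    using p1_plus_p2_square[of 1 x] p1_plus_p2_square[of "- 1" x] by (simp add: algebra_simps)
  also have "p1 (x \<bullet>\<^sub>J x) = (p1 x)\<^sup>2"
    using p1_plus_p2_square[of 0 x] by simp
  finally have "(p2 x)\<^sup>2 = 0" by (simp add: power2_eq_square algebra_simps)
  then show ?thesis by simp
qed

lemma psi_linear: "Vector_Spaces.linear scaleC (*) psi"
  using p1_linear psi_eq_p1_p2 by (simp add: p2_eq_0 Vector_Spaces.linear_iff)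

lemma psi_square: "psi (x \<bullet>\<^sub>J x) = (psi x)\<^sup>2"
  using p1_plus_p2_square[of 0 x] by (simp add: psi_eq_p1_p2 p2_eq_0)

lemma psi_mult: "psi (x \<bullet>\<^sub>J y) = psi x * psi y"
proof -
  have "(x + y) \<bullet>\<^sub>J (x + y) = x \<bullet>\<^sub>J x + y \<bullet>\<^sub>J y + (x \<bullet>\<^sub>J y + x \<bullet>\<^sub>J y)"
    by (simp add: jprod.add_left jprod.add_right jprod_commute algebra_simps)
  then have "(psi x + psi y)\<^sup>2 = (psi x)\<^sup>2 + (psi y)\<^sup>2 + 2 * psi (x \<bullet>\<^sub>J y)"
    using psi_square[of "x + y"] by (simp only: psi_add psi_square mult_2)
  then show ?thesis by (simp add: power2_eq_square algebra_simps)
qed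

lemma psi_bounded_linear: "bounded_linear psi"
  by (rule bounded_linear_intro[where K = 1])
     (simp_all add: psi_add psi_scaleR scaleR_conv_of_real cmod_psi_le)

text \<open>Being continuous and multiplicative, \<open>psi\<close> passes through the exponential
  series, so both sides equal \<open>exp (psi x)\<close>.\<close>

lemma psi_jexp: "psi (E x) = f (E x)"
proof -
  have "psi \<one>\<^sub>J = 1" using psi_scaleC_unit[of 1] by simp
  then have pow: "psi (jpow x n) = psi x ^ n" for n
    by (induction n) (simp_all add: psi_mult)
  have "(\<lambda>n. psi (jpow x n /\<^sub>R fact n)) sums psi (E x)"
    by (rule bounded_linear.sums[OF psi_bounded_linear jexp_sums])
  then have "(\<lambda>n. psi x ^ n /\<^sub>R fact n) sums psi (E x)"
    by (simp add: psi_scaleR pow scaleR_conv_of_real)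
  then have "psi (E x) = exp (psi x)" using exp_converges sums_unique2 by blast
  then show ?thesis using f_jexp_scaleR[of 1 x] by simp
qed

section \<open>Uniqueness and conclusion\<close>

text \<open>Agreement on exponentials extends by linearity to the quotients \<open>q t\<close>,
  which tend to \<open>x\<close>; continuity of both functionals finishes.\<close>

lemma linear_eq_psiI:
  assumes cont: "continuous_on UNIV \<phi>" and lin: "Vector_Spaces.linear scaleC (*) \<phi>"
    and exp: "\<And>x. f (E x) = \<phi> (E x)"
  shows "\<phi> = psi"
proof
  fix x
  interpret \<phi>: Vector_Spaces.linear scaleC "(*)" \<phi> by fact
  define q where "q t = (E (t *\<^sub>R x) - E (0 *\<^sub>R x)) /\<^sub>R t" for t
  have q: "(q \<longlongrightarrow> x) (at 0)"
    unfolding q_def by (rule has_vector_derivative_quotient_tendsto[OF jexp_has_vector_derivative_0])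
  have "((\<lambda>t. \<phi> (q t)) \<longlongrightarrow> \<phi> x) (at 0)"
    by (rule continuous_on_tendsto_compose[OF cont q]) auto
  moreover have "((\<lambda>t. psi (q t)) \<longlongrightarrow> psi x) (at 0)"
    by (rule bounded_linear.tendsto[OF psi_bounded_linear q])
  moreover have "\<phi> (q t) = psi (q t)" for t
  proof -
    interpret psi: Vector_Spaces.linear scaleC "(*)" psi by (rule psi_linear)
    show ?thesis
      unfolding q_def scaleC_of_real[symmetric] \<phi>.scale psi.scale \<phi>.diff psi.diff
      by (simp add: psi_jexp flip: exp)
  qed
  ultimately show "\<phi> x = psi x" using LIM_unique[of "\<lambda>t. psi (q t)" _ 0] by simp
qed

end

theorem theorem3p7:
  fixes scaleC :: "complex \<Rightarrow> 'a::banach \<Rightarrow> 'a"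
    and jprod :: "'a \<Rightarrow> 'a \<Rightarrow> 'a" (infixl "\<bullet>\<^sub>J" 70)
    and unit :: 'a
    and f :: "'a \<Rightarrow> complex"
  assumes "unital_jordan_banach_algebra scaleC jprod unit"
    and "\<And>x. f x \<in> jspectrum scaleC jprod unit x"
    and "\<And>x y. f (x \<bullet>\<^sub>J y) = f x * f y"
  shows "\<exists>!\<psi> :: 'a \<Rightarrow> complex.
      continuous_on UNIV \<psi> \<and>
      Vector_Spaces.linear scaleC (*) \<psi> \<and>
      (\<forall>x y. \<psi> (x \<bullet>\<^sub>J y) = \<psi> x * \<psi> y) \<and>
      (\<forall>x. f (jexp jprod unit x) = \<psi> (jexp jprod unit x))"
proof -
  interpret multiplicative_spectral_functional scaleC jprod unit f
    using assms by (simp add: multiplicative_spectral_functional_def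
        multiplicative_spectral_functional_axioms_def)
  show ?thesis
  proof (rule ex1I[of _ psi])
    show "continuous_on UNIV psi \<and> Vector_Spaces.linear scaleC (*) psi \<and>
        (\<forall>x y. psi (x \<bullet>\<^sub>J y) = psi x * psi y) \<and>
        (\<forall>x. f (jexp jprod unit x) = psi (jexp jprod unit x))"
      by (simp add: linear_continuous_on psi_bounded_linear psi_linear psi_mult psi_jexp)
  qed (auto intro: linear_eq_psiI)
qed

end
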